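(* Let $\mathbb{K}$ be $\mathbb{C}$ or $\mathbb{R}$ and let $\mathfrak{h}_2$ be the $5$-dimensional Heisenberg Lie algebra over $\mathbb{K}$ with basis $\{e_1,\dots,e_5\}$ and nonzero brackets $[e_1,e_3]=e_5$, $[e_2,e_4]=e_5$ (up to skew-symmetry). For $p,q\in\mathbb{K}$ let $\phi_5(p:q):\mathfrak{h}_2\times\mathfrak{h}_2\to\mathfrak{h}_2$ be the skew-symmetric bilinear map with $$\phi_5(e_1,e_3)=pe_1,\quad \phi_5(e_2,e_3)=e_1+qe_2+e_4,\quad \phi_5(e_3,e_4)=-pe_4,\quad \phi_5(e_3,e_5)=-(p+q)e_5,$$ and all other values on pairs $(e_i,e_j)$ with $i<j$ equal to zero. Then for all $p,q\in\mathbb{K}$ the map $\phi_5(p:q)$ is a $2$-cocycle of $\mathfrak{h}_2$ with adjoint coefficients, and $\mu_t(d_5)(p:q)=[-,-]+t\,\phi_5(p:q)$, i.e. the bracket with nonzero values (up to skew-symmetry) $$[e_1,e_3]_t=e_5+pte_1,\quad [e_2,e_3]_t=te_1+qte_2+te_4,\quad [e_2,e_4]_t=e_5,\quad [e_3,e_4]_t=-pte_4,\quad [e_3,e_5]_t=-(p+q)te_5,$$ is an infinitesimal deformation of $\mathfrak{h}_2$. Moreover, the linear span in $H^2(\mathfrak{h}_2,\mathfrak{h}_2)$ of the cohomology classes of the cocycles $\phi_5(p:q)$, $p,q\in\mathbb{K}$, is $3$-dimensional.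
   Context: For a Lie algebra $(\mathfrak{g},[-,-])$ over $\mathbb{K}$, $C^q(\mathfrak{g},\mathfrak{g})=\mathrm{Hom}_{\mathbb{K}}(\Lambda^q\mathfrak{g},\mathfrak{g})$ is the Chevalley--Eilenberg cochain space with adjoint coefficients, with differential $d$, and $H^q(\mathfrak{g},\mathfrak{g})$ denotes its cohomology. A $2$-cochain $\phi$ is a $2$-cocycle iff the cyclic sum over $(x,y,z)$ of $[x,\phi(y,z)]+\phi(x,[y,z])$ vanishes for all $x,y,z\in\mathfrak{g}$; the $2$-coboundaries are the maps $(x,y)\mapsto f([x,y])-[f(x),y]-[x,f(y)]$ with $f:\mathfrak{g}\to\mathfrak{g}$ linear. Given a $2$-cochain $\phi$, extend the bracket $[-,-]_t=[-,-]+t\phi$ to $\mathfrak{g}[[t]]$ by $\mathbb{K}[[t]]$-bilinearity. It is called an infinitesimal deformation of $\mathfrak{g}$ if it satisfies the Jacobi identity modulo $t^2$ (equivalently, $\phi$ is a $2$-cocycle). *)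

theory Defs
  imports
    "HOL-Analysis.Analysis"
    "HOL-Computational_Algebra.Formal_Power_Series"
begin

section \<open>Chevalley--Eilenberg cohomology with adjoint coefficients\<close>

text \<open>
  The tuple \<open>(x\<^sub>0, \<dots>, x\<^sub>n\<^sub>-\<^sub>1)\<close> is encoded by a sequence \<open>v :: nat \<Rightarrow> 'g\<close> of which only the
  entries below \<open>n\<close> matter; \<open>omit i v\<close> deletes its \<open>i\<close>-th entry.
\<close>

definition omit :: "nat \<Rightarrow> (nat \<Rightarrow> 'g) \<Rightarrow> (nat \<Rightarrow> 'g)"
  where "omit i v = (\<lambda>k. if k < i then v k else v (Suc k))"

text \<open>A map of two arguments as a map on tuples.\<close>

definition cochain2 :: "('g \<Rightarrow> 'g \<Rightarrow> 'g) \<Rightarrow> (nat \<Rightarrow> 'g) \<Rightarrow> 'g"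
  where "cochain2 \<phi> = (\<lambda>v. \<phi> (v 0) (v 1))"

text \<open>
  The Cauchy product with respect to \<open>b\<close>. For bilinear \<open>b\<close> this is its extension to formal power
  series over \<open>\<bbbK>[[t]]\<close>. Elements of \<open>\<gg>[[t]]\<close> are represented by \<open>'g fps\<close>.
\<close>

definition cauchy :: "('a::zero \<Rightarrow> 'b::zero \<Rightarrow> 'c::comm_monoid_add) \<Rightarrow> 'a fps \<Rightarrow> 'b fps \<Rightarrow> 'c fps"
  where "cauchy b x y = Abs_fps (\<lambda>n. \<Sum>i=0..n. b (fps_nth x i) (fps_nth y (n - i)))"

locale lie_algebra = vector_space scale
  for scale :: "'k::field \<Rightarrow> 'g::ab_group_add \<Rightarrow> 'g" +
  fixes bracket :: "'g \<Rightarrow> 'g \<Rightarrow> 'g"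
  assumes linear_bracket_left: "Vector_Spaces.linear scale scale (\<lambda>x. bracket x y)"
    and linear_bracket_right: "Vector_Spaces.linear scale scale (\<lambda>y. bracket x y)"
    and bracket_self: "bracket x x = 0"
    and jacobi: "bracket x (bracket y z) + bracket y (bracket z x) + bracket z (bracket x y) = 0"
begin

text \<open>
  \<open>Hom (\<Lambda>\<^sup>q \<gg>, \<gg>)\<close> as the alternating \<open>q\<close>-linear maps. The first conjunct says that the map
  depends only on the first \<open>q\<close> entries of the sequence.
\<close>

definition cochains :: "nat \<Rightarrow> ((nat \<Rightarrow> 'g) \<Rightarrow> 'g) set"
  where "cochains q = {\<phi>.
    (\<forall>v w. (\<forall>i<q. v i = w i) \<longrightarrow> \<phi> v = \<phi> w) \<and>
    (\<forall>v. \<forall>i<q. Vector_Spaces.linear scale scale (\<lambda>x. \<phi> (v(i := x)))) \<and>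
    (\<forall>v. \<forall>i<q. \<forall>j<q. i \<noteq> j \<longrightarrow> v i = v j \<longrightarrow> \<phi> v = 0)}"

text \<open>In the second sum \<open>i < j\<close>, so the \<open>j\<close>-th entry has to be deleted before the \<open>i\<close>-th.\<close>

definition differential :: "nat \<Rightarrow> ((nat \<Rightarrow> 'g) \<Rightarrow> 'g) \<Rightarrow> ((nat \<Rightarrow> 'g) \<Rightarrow> 'g)"
  where "differential q \<phi> = (\<lambda>v.
    (\<Sum>i\<le>q. scale ((-1) ^ i) (bracket (v i) (\<phi> (omit i v)))) +
    (\<Sum>j\<le>q. \<Sum>i<j. scale ((-1) ^ (i + j))
      (\<phi> (case_nat (bracket (v i) (v j)) (omit i (omit j v))))))"

definition cocycles :: "nat \<Rightarrow> ((nat \<Rightarrow> 'g) \<Rightarrow> 'g) set"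
  where "cocycles q = {\<phi> \<in> cochains q. differential q \<phi> = (\<lambda>_. 0)}"

definition coboundaries :: "nat \<Rightarrow> ((nat \<Rightarrow> 'g) \<Rightarrow> 'g) set"
  where "coboundaries q =
    (case q of 0 \<Rightarrow> {\<lambda>_. 0} | Suc p \<Rightarrow> differential p ` cochains p)"

text \<open>The classes of this partial equivalence relation are the elements of \<open>H\<^sup>q(\<gg>, \<gg>)\<close>.\<close>

definition cohomologous :: "nat \<Rightarrow> ((nat \<Rightarrow> 'g) \<Rightarrow> 'g) \<Rightarrow> ((nat \<Rightarrow> 'g) \<Rightarrow> 'g) \<Rightarrow> bool"
  where "cohomologous q \<phi> \<psi> \<longleftrightarrow>
    \<phi> \<in> cocycles q \<and> \<psi> \<in> cocycles q \<and> (\<lambda>v. \<phi> v - \<psi> v) \<in> coboundaries q"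

text \<open>The bracket \<open>[-,-] + t \<phi>\<close> on \<open>\<gg>[[t]]\<close>; \<open>cauchy scale\<close> is the action of \<open>\<bbbK>[[t]]\<close>.\<close>

definition deformed_bracket :: "('g \<Rightarrow> 'g \<Rightarrow> 'g) \<Rightarrow> 'g fps \<Rightarrow> 'g fps \<Rightarrow> 'g fps"
  where "deformed_bracket \<phi> x y = cauchy bracket x y + cauchy scale fps_X (cauchy \<phi> x y)"

definition infinitesimal_deformation :: "('g \<Rightarrow> 'g \<Rightarrow> 'g) \<Rightarrow> bool"
  where "infinitesimal_deformation \<phi> \<longleftrightarrow>
    cochain2 \<phi> \<in> cochains 2 \<and>
    (let m = deformed_bracket \<phi> in
      \<forall>x y z. \<forall>n<2. fps_nth (m x (m y z) + m y (m z x) + m z (m x y)) n = 0)"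

lemma bracket_simps:
  "bracket (x + y) z = bracket x z + bracket y z"
  "bracket z (x + y) = bracket z x + bracket z y"
  "bracket (x - y) z = bracket x z - bracket y z"
  "bracket z (x - y) = bracket z x - bracket z y"
  "bracket (scale a x) z = scale a (bracket x z)"
  "bracket z (scale a x) = scale a (bracket z x)"
  "bracket 0 z = 0"
  "bracket z 0 = 0"
  "bracket (- x) z = - bracket x z"
  "bracket z (- x) = - bracket z x"
proof -
  interpret l: Vector_Spaces.linear scale scale "\<lambda>x. bracket x y" for y
    by (rule linear_bracket_left)
  interpret r: Vector_Spaces.linear scale scale "\<lambda>y. bracket x y" for x
    by (rule linear_bracket_right)
  show "bracket (x + y) z = bracket x z + bracket y z"
    "bracket z (x + y) = bracket z x + bracket z y"
    "bracket (x - y) z = bracket x z - bracket y z"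
    "bracket z (x - y) = bracket z x - bracket z y"
    "bracket (scale a x) z = scale a (bracket x z)"
    "bracket z (scale a x) = scale a (bracket z x)"
    "bracket 0 z = 0" "bracket z 0 = 0"
    "bracket (- x) z = - bracket x z" "bracket z (- x) = - bracket z x"
    by (simp_all add: l.add r.add l.diff r.diff l.scale r.scale l.neg r.neg)
qed

lemma bracket_skew: "bracket x y = - bracket y x"
proof -
  have "bracket x y + bracket y x = bracket (x + y) (x + y)"
    by (simp only: bracket_simps) (simp add: bracket_self)
  then show ?thesis
    by (simp add: bracket_self eq_neg_iff_add_eq_0)
qed

lemma linear_add_fun:
  assumes "Vector_Spaces.linear scale scale f" "Vector_Spaces.linear scale scale g"
  shows "Vector_Spaces.linear scale scale (\<lambda>x. f x + g x)"
  using assms vector_space_pair.linear_compose_add[of scale scale f g] vector_space_axioms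
  unfolding vector_space_pair_def by blast

lemma linear_scale_fun:
  assumes "Vector_Spaces.linear scale scale f"
  shows "Vector_Spaces.linear scale scale (\<lambda>x. scale a (f x))"
  using assms vector_space_pair.linear_compose_scale_right[of scale scale f a] vector_space_axioms
  unfolding vector_space_pair_def by blast

lemma cochainsD:
  assumes "\<phi> \<in> cochains q"
  shows cochains_cong: "(\<And>i. i < q \<Longrightarrow> v i = w i) \<Longrightarrow> \<phi> v = \<phi> w"
    and cochains_linear: "i < q \<Longrightarrow> Vector_Spaces.linear scale scale (\<lambda>x. \<phi> (v(i := x)))"
    and cochains_alternating: "i < q \<Longrightarrow> j < q \<Longrightarrow> i \<noteq> j \<Longrightarrow> v i = v j \<Longrightarrow> \<phi> v = 0"
  using assms by (simp_all add: cochains_def)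

lemma cochains_zero: "(\<lambda>_. 0) \<in> cochains q"
proof -
  have "Vector_Spaces.linear scale scale (\<lambda>x. 0)"
    by unfold_locales (simp_all)
  then show ?thesis by (simp add: cochains_def)
qed

lemma cochains_add:
  assumes "\<phi> \<in> cochains q" "\<psi> \<in> cochains q"
  shows "(\<lambda>v. \<phi> v + \<psi> v) \<in> cochains q"
  unfolding cochains_def mem_Collect_eq
proof (intro conjI allI impI)
  fix v w :: "nat \<Rightarrow> 'g" assume "\<forall>i<q. v i = w i"
  then have "\<phi> v = \<phi> w" "\<psi> v = \<psi> w"
    using assms by (auto intro: cochains_cong)
  then show "\<phi> v + \<psi> v = \<phi> w + \<psi> w" by simp
next
  fix v :: "nat \<Rightarrow> 'g" and i assume "i < q"
  show "Vector_Spaces.linear scale scale (\<lambda>x. \<phi> (v(i := x)) + \<psi> (v(i := x)))"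
    by (intro linear_add_fun cochains_linear[OF assms(1) \<open>i < q\<close>]
        cochains_linear[OF assms(2) \<open>i < q\<close>])
next
  fix v :: "nat \<Rightarrow> 'g" and i j assume "i < q" "j < q" "i \<noteq> j" "v i = v j"
  then have "\<phi> v = 0" "\<psi> v = 0" using assms cochains_alternating by metis+
  then show "\<phi> v + \<psi> v = 0" by simp
qed

lemma cochains_scale:
  assumes "\<phi> \<in> cochains q"
  shows "(\<lambda>v. scale a (\<phi> v)) \<in> cochains q"
  unfolding cochains_def mem_Collect_eq
proof (intro conjI allI impI)
  fix v w :: "nat \<Rightarrow> 'g" assume "\<forall>i<q. v i = w i"
  then have "\<phi> v = \<phi> w" using assms by (auto intro: cochains_cong)
  then show "scale a (\<phi> v) = scale a (\<phi> w)" by simp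
next
  fix v :: "nat \<Rightarrow> 'g" and i assume "i < q"
  show "Vector_Spaces.linear scale scale (\<lambda>x. scale a (\<phi> (v(i := x))))"
    by (intro linear_scale_fun cochains_linear[OF assms \<open>i < q\<close>])
next
  fix v :: "nat \<Rightarrow> 'g" and i j assume "i < q" "j < q" "i \<noteq> j" "v i = v j"
  then have "\<phi> v = 0" using assms cochains_alternating by metis
  then show "scale a (\<phi> v) = 0" by simp
qed

lemma differential_zero: "differential q (\<lambda>_. 0) = (\<lambda>_. 0)"
  by (simp add: differential_def bracket_simps)

lemma differential_add:
  "differential q (\<lambda>v. \<phi> v + \<psi> v) = (\<lambda>v. differential q \<phi> v + differential q \<psi> v)"
  by (simp add: differential_def bracket_simps scale_right_distrib sum.distrib algebra_simps)

lemma differential_scale: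
  "differential q (\<lambda>v. scale a (\<phi> v)) = (\<lambda>v. scale a (differential q \<phi> v))"
  by (simp add: differential_def bracket_simps scale_right_distrib scale_sum_right mult.commute)

lemma cocycles_zero: "(\<lambda>_. 0) \<in> cocycles q"
  by (simp add: cocycles_def cochains_zero differential_zero)

lemma cocycles_add:
  "\<phi> \<in> cocycles q \<Longrightarrow> \<psi> \<in> cocycles q \<Longrightarrow> (\<lambda>v. \<phi> v + \<psi> v) \<in> cocycles q"
  by (simp add: cocycles_def cochains_add differential_add)

lemma cocycles_scale: "\<phi> \<in> cocycles q \<Longrightarrow> (\<lambda>v. scale a (\<phi> v)) \<in> cocycles q"
  by (simp add: cocycles_def cochains_scale differential_scale)

lemma coboundaries_zero: "(\<lambda>_. 0) \<in> coboundaries q"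
proof (cases q)
  case (Suc p)
  have "(\<lambda>_. 0) = differential p (\<lambda>_. 0)" by (simp add: differential_zero)
  then show ?thesis using cochains_zero[of p] Suc by (auto simp: coboundaries_def)
qed (simp add: coboundaries_def)

lemma coboundaries_add:
  assumes "\<phi> \<in> coboundaries q" "\<psi> \<in> coboundaries q"
  shows "(\<lambda>v. \<phi> v + \<psi> v) \<in> coboundaries q"
proof (cases q)
  case (Suc p)
  then obtain f g where "f \<in> cochains p" "g \<in> cochains p"
    "\<phi> = differential p f" "\<psi> = differential p g"
    using assms by (auto simp: coboundaries_def)
  then have "(\<lambda>v. \<phi> v + \<psi> v) = differential p (\<lambda>v. f v + g v)" "(\<lambda>v. f v + g v) \<in> cochains p"
    by (simp_all add: differential_add cochains_add)
  then show ?thesis using Suc by (auto simp: coboundaries_def)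
qed (use assms in \<open>simp add: coboundaries_def\<close>)

lemma coboundaries_scale:
  assumes "\<phi> \<in> coboundaries q"
  shows "(\<lambda>v. scale a (\<phi> v)) \<in> coboundaries q"
proof (cases q)
  case (Suc p)
  then obtain f where "f \<in> cochains p" "\<phi> = differential p f"
    using assms by (auto simp: coboundaries_def)
  then have "(\<lambda>v. scale a (\<phi> v)) = differential p (\<lambda>v. scale a (f v))"
    "(\<lambda>v. scale a (f v)) \<in> cochains p"
    by (simp_all add: differential_scale cochains_scale)
  then show ?thesis using Suc by (auto simp: coboundaries_def)
qed (use assms in \<open>simp add: coboundaries_def\<close>)

lemma cohomologous_add:
  assumes "cohomologous q \<phi> \<phi>'" "cohomologous q \<psi> \<psi>'"
  shows "cohomologous q (\<lambda>v. \<phi> v + \<psi> v) (\<lambda>v. \<phi>' v + \<psi>' v)"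
proof -
  have "(\<lambda>v. (\<phi> v - \<phi>' v) + (\<psi> v - \<psi>' v)) \<in> coboundaries q"
    using assms by (intro coboundaries_add) (auto simp: cohomologous_def)
  then show ?thesis
    using assms by (simp add: cohomologous_def cocycles_add add_diff_add)
qed

lemma cohomologous_scale:
  assumes "cohomologous q \<phi> \<phi>'"
  shows "cohomologous q (\<lambda>v. scale a (\<phi> v)) (\<lambda>v. scale a (\<phi>' v))"
proof -
  have "(\<lambda>v. scale a (\<phi> v - \<phi>' v)) \<in> coboundaries q"
    using assms by (intro coboundaries_scale) (auto simp: cohomologous_def)
  then show ?thesis
    using assms by (simp add: cohomologous_def cocycles_scale scale_right_diff_distrib)
qed

lemma cohomologous_refl: "\<phi> \<in> cocycles q \<Longrightarrow> cohomologous q \<phi> \<phi>"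
  by (simp add: cohomologous_def coboundaries_zero)

lemma part_equivp_cohomologous: "part_equivp (cohomologous q)"
proof (rule part_equivpI)
  show "\<exists>x. cohomologous q x x"
    using cocycles_zero cohomologous_refl by blast
  show "symp (cohomologous q)"
  proof (rule sympI)
    fix \<phi> \<psi> assume *: "cohomologous q \<phi> \<psi>"
    then have "(\<lambda>v. scale (-1) (\<phi> v - \<psi> v)) \<in> coboundaries q"
      by (intro coboundaries_scale) (auto simp: cohomologous_def)
    with * show "cohomologous q \<psi> \<phi>" by (simp add: cohomologous_def)
  qed
  show "transp (cohomologous q)"
  proof (rule transpI)
    fix \<phi> \<psi> \<eta> assume *: "cohomologous q \<phi> \<psi>" "cohomologous q \<psi> \<eta>"
    then have "(\<lambda>v. (\<phi> v - \<psi> v) + (\<psi> v - \<eta> v)) \<in> coboundaries q"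
      by (intro coboundaries_add) (auto simp: cohomologous_def)
    with * show "cohomologous q \<phi> \<eta>" by (simp add: cohomologous_def)
  qed
qed

text \<open>In low degrees these notions are the familiar ones.\<close>

lemma cochain2_in_cochains_iff:
  "cochain2 \<phi> \<in> cochains 2 \<longleftrightarrow>
    (\<forall>y. Vector_Spaces.linear scale scale (\<lambda>x. \<phi> x y)) \<and>
    (\<forall>x. Vector_Spaces.linear scale scale (\<lambda>y. \<phi> x y)) \<and> (\<forall>x. \<phi> x x = 0)"
  (is "?L \<longleftrightarrow> ?R")
proof
  assume L: ?L
  show ?R
  proof (intro conjI allI)
    fix y
    have "Vector_Spaces.linear scale scale (\<lambda>x. cochain2 \<phi> ((\<lambda>_. y)(0 := x)))"
      by (rule cochains_linear[OF L]) simp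
    then show "Vector_Spaces.linear scale scale (\<lambda>x. \<phi> x y)" by (simp add: cochain2_def)
  next
    fix x
    have "Vector_Spaces.linear scale scale (\<lambda>y. cochain2 \<phi> ((\<lambda>_. x)(1 := y)))"
      by (rule cochains_linear[OF L]) simp
    then show "Vector_Spaces.linear scale scale (\<lambda>y. \<phi> x y)" by (simp add: cochain2_def)
  next
    fix x
    have "cochain2 \<phi> (\<lambda>_. x) = 0"
      using cochains_alternating[OF L, of 0 1 "\<lambda>_. x"] by simp
    then show "\<phi> x x = 0" by (simp add: cochain2_def)
  qed
next
  assume R: ?R
  then show ?L
    by (auto simp: cochains_def cochain2_def less_2_cases_iff)
qed

lemma differential_cochain2:
  assumes "cochain2 \<phi> \<in> cochains 2"
  shows "differential 2 (cochain2 \<phi>) v =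
    (let x = v 0; y = v 1; z = v 2 in
      bracket x (\<phi> y z) + \<phi> x (bracket y z) +
      bracket y (\<phi> z x) + \<phi> y (bracket z x) +
      bracket z (\<phi> x y) + \<phi> z (bracket x y))"
proof -
  have lin: "Vector_Spaces.linear scale scale (\<lambda>x. \<phi> x y)"
    "Vector_Spaces.linear scale scale (\<lambda>y. \<phi> x y)" and self: "\<phi> x x = 0" for x y
    using assms unfolding cochain2_in_cochains_iff by blast+
  interpret l: Vector_Spaces.linear scale scale "\<lambda>x. \<phi> x y" for y by (rule lin)
  interpret r: Vector_Spaces.linear scale scale "\<lambda>y. \<phi> x y" for x by (rule lin)
  have skew: "\<phi> x y = - \<phi> y x" for x y
  proof -
    have "\<phi> x y + \<phi> y x = \<phi> (x + y) (x + y)"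
      by (simp only: l.add r.add) (simp add: self)
    then show ?thesis by (simp add: self eq_neg_iff_add_eq_0)
  qed
  have "differential 2 (cochain2 \<phi>) v =
      bracket (v 0) (\<phi> (v 1) (v 2)) - bracket (v 1) (\<phi> (v 0) (v 2)) + bracket (v 2) (\<phi> (v 0) (v 1))
      - \<phi> (bracket (v 0) (v 1)) (v 2) + \<phi> (bracket (v 0) (v 2)) (v 1) - \<phi> (bracket (v 1) (v 2)) (v 0)"
    by (simp add: differential_def cochain2_def omit_def numeral_2_eq_2 lessThan_Suc atMost_Suc)
  also have "\<phi> (bracket (v 0) (v 1)) (v 2) = - \<phi> (v 2) (bracket (v 0) (v 1))"
    by (rule skew)
  also have "\<phi> (bracket (v 0) (v 2)) (v 1) = \<phi> (v 1) (bracket (v 2) (v 0))"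
    by (subst skew, subst bracket_skew) (simp add: r.neg)
  also have "\<phi> (bracket (v 1) (v 2)) (v 0) = - \<phi> (v 0) (bracket (v 1) (v 2))"
    by (rule skew)
  also have "bracket (v 1) (\<phi> (v 0) (v 2)) = - bracket (v 1) (\<phi> (v 2) (v 0))"
    by (subst skew) (simp add: bracket_simps)
  finally show ?thesis by (simp add: Let_def algebra_simps)
qed

lemma cochain2_cocycle_iff:
  "cochain2 \<phi> \<in> cocycles 2 \<longleftrightarrow> cochain2 \<phi> \<in> cochains 2 \<and>
    (\<forall>x y z. bracket x (\<phi> y z) + \<phi> x (bracket y z) +
      bracket y (\<phi> z x) + \<phi> y (bracket z x) +
      bracket z (\<phi> x y) + \<phi> z (bracket x y) = 0)"
proof -
  have "differential 2 (cochain2 \<phi>) = (\<lambda>_. 0) \<longleftrightarrow> (\<forall>x y z. bracket x (\<phi> y z) + \<phi> x (bracket y z) +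
      bracket y (\<phi> z x) + \<phi> y (bracket z x) + bracket z (\<phi> x y) + \<phi> z (bracket x y) = 0)"
    if c: "cochain2 \<phi> \<in> cochains 2"
  proof (intro iffI allI ext)
    fix x y z assume "differential 2 (cochain2 \<phi>) = (\<lambda>_. 0)"
    moreover define v where "v = (case_nat x (case_nat y (\<lambda>_. z)) :: nat \<Rightarrow> 'g)"
    ultimately have "differential 2 (cochain2 \<phi>) v = 0" by simp
    moreover have "v 0 = x" "v 1 = y" "v 2 = z"
      by (simp_all add: v_def numeral_2_eq_2)
    ultimately show "bracket x (\<phi> y z) + \<phi> x (bracket y z) +
      bracket y (\<phi> z x) + \<phi> y (bracket z x) + bracket z (\<phi> x y) + \<phi> z (bracket x y) = 0"
      by (simp add: differential_cochain2[OF c] Let_def)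
  qed (simp add: differential_cochain2[OF c] Let_def)
  then show ?thesis by (auto simp: cocycles_def)
qed

lemma coboundaries_2_eq:
  "coboundaries 2 = {cochain2 (\<lambda>x y. f (bracket x y) - bracket (f x) y - bracket x (f y)) | f.
    Vector_Spaces.linear scale scale f}" (is "_ = ?R")
proof -
  have d1: "differential 1 (\<lambda>v. f (v 0)) = cochain2 (\<lambda>x y. - (f (bracket x y) - bracket (f x) y - bracket x (f y)))"
    for f
  proof (rule ext)
    fix v
    have "differential 1 (\<lambda>v. f (v 0)) v = bracket (v 0) (f (v 1)) - bracket (v 1) (f (v 0)) - f (bracket (v 0) (v 1))"
      by (simp add: differential_def omit_def lessThan_Suc atMost_Suc)
    also have "bracket (v 1) (f (v 0)) = - bracket (f (v 0)) (v 1)" by (rule bracket_skew)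
    finally show "differential 1 (\<lambda>v. f (v 0)) v =
      cochain2 (\<lambda>x y. - (f (bracket x y) - bracket (f x) y - bracket x (f y))) v"
      by (simp add: cochain2_def)
  qed
  have c1: "g \<in> cochains 1 \<longleftrightarrow> (\<exists>f. Vector_Spaces.linear scale scale f \<and> g = (\<lambda>v. f (v 0)))" for g
  proof
    assume g: "g \<in> cochains 1"
    have 1: "g v = g ((\<lambda>_. 0)(0 := v 0))" for v
      using g by (rule cochains_cong) simp
    have 2: "Vector_Spaces.linear scale scale (\<lambda>x. g ((\<lambda>_. 0)(0 := x)))"
      using g by (rule cochains_linear) simp
    show "\<exists>f. Vector_Spaces.linear scale scale f \<and> g = (\<lambda>v. f (v 0))"
      using 1 2 by (intro exI[of _ "\<lambda>x. g ((\<lambda>_. 0)(0 := x))"]) (auto simp: fun_eq_iff)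
  next
    assume "\<exists>f. Vector_Spaces.linear scale scale f \<and> g = (\<lambda>v. f (v 0))"
    then show "g \<in> cochains 1" by (auto simp: cochains_def)
  qed
  have neg: "Vector_Spaces.linear scale scale (\<lambda>x. - f x)" if "Vector_Spaces.linear scale scale f" for f
    using linear_scale_fun[OF that, of "-1"] by simp
  have "coboundaries 2 = differential 1 ` cochains 1"
    by (simp add: coboundaries_def numeral_2_eq_2)
  also have "\<dots> = ?R"
  proof (intro equalityI subsetI)
    fix \<phi> assume "\<phi> \<in> differential 1 ` cochains 1"
    then obtain f where f: "Vector_Spaces.linear scale scale f" "\<phi> = differential 1 (\<lambda>v. f (v 0))"
      using c1 by auto
    then show "\<phi> \<in> ?R" using neg[OF f(1)]
      by (intro CollectI exI[of _ "\<lambda>x. - f x"]) (simp add: d1 bracket_simps algebra_simps del: One_nat_def)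
  next
    fix \<phi> assume "\<phi> \<in> ?R"
    then obtain f where f: "Vector_Spaces.linear scale scale f"
      "\<phi> = cochain2 (\<lambda>x y. f (bracket x y) - bracket (f x) y - bracket x (f y))" by auto
    then have "\<phi> = differential 1 (\<lambda>v. - f (v 0))"
      by (simp add: d1[of "\<lambda>x. - f x"] bracket_simps algebra_simps del: One_nat_def)
    moreover have "(\<lambda>v. - f (v 0)) \<in> cochains 1" using neg[OF f(1)] c1 by blast
    ultimately show "\<phi> \<in> differential 1 ` cochains 1" by blast
  qed
  finally show ?thesis .
qed

end

section \<open>The Heisenberg Lie algebra of dimension 5\<close>

text \<open>
  \<open>wedge i j\<close> is the alternating form \<open>e\<^sup>i \<and> e\<^sup>j\<close>, which is \<open>1\<close> on \<open>(e\<^sub>i, e\<^sub>j)\<close> and \<open>0\<close> on the other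
  pairs of basis vectors (up to skew-symmetry). In the index type \<open>5\<close> the numeral \<open>5\<close> equals \<open>0\<close>,
  so that its elements are \<open>1, 2, 3, 4, 5\<close>.
\<close>

abbreviation ee :: "5 \<Rightarrow> 'k::field ^ 5"
  where "ee i \<equiv> axis i 1"

definition wedge :: "5 \<Rightarrow> 5 \<Rightarrow> 'k::field ^ 5 \<Rightarrow> 'k ^ 5 \<Rightarrow> 'k"
  where "wedge i j x y = x $ i * y $ j - x $ j * y $ i"

definition h2_bracket :: "'k::field ^ 5 \<Rightarrow> 'k ^ 5 \<Rightarrow> 'k ^ 5"
  where "h2_bracket x y = wedge 1 3 x y *s ee 5 + wedge 2 4 x y *s ee 5"

definition phi5 :: "'k::field \<Rightarrow> 'k \<Rightarrow> 'k ^ 5 \<Rightarrow> 'k ^ 5 \<Rightarrow> 'k ^ 5"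
  where "phi5 p q x y =
    wedge 1 3 x y *s (p *s ee 1) +
    wedge 2 3 x y *s (ee 1 + q *s ee 2 + ee 4) +
    wedge 3 4 x y *s (- p *s ee 4) +
    wedge 3 5 x y *s (- (p + q) *s ee 5)"

interpretation h2: lie_algebra "(*s) :: 'k::field \<Rightarrow> 'k ^ 5 \<Rightarrow> 'k ^ 5" h2_bracket
proof
  fix x y z w :: "'k ^ 5" and a :: 'k
  show "h2_bracket (x + w) y = h2_bracket x y + h2_bracket w y"
    "h2_bracket x (y + w) = h2_bracket x y + h2_bracket x w"
    "h2_bracket (a *s x) y = a *s h2_bracket x y"
    "h2_bracket x (a *s y) = a *s h2_bracket x y"
    by (simp_all add: h2_bracket_def wedge_def vec_eq_iff algebra_simps)
  show "h2_bracket x x = 0"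
    by (simp add: h2_bracket_def wedge_def)
  show "h2_bracket x (h2_bracket y z) + h2_bracket y (h2_bracket z x) + h2_bracket z (h2_bracket x y) = 0"
    by (simp add: h2_bracket_def wedge_def axis_def)
qed

text \<open>The space \<open>H\<^sup>2(\<hh>\<^sub>2, \<hh>\<^sub>2)\<close>.\<close>

quotient_type (overloaded) 'k H2_h2 = "(nat \<Rightarrow> 'k::field ^ 5) \<Rightarrow> 'k ^ 5" /
    partial: "h2.cohomologous 2 :: ((nat \<Rightarrow> 'k ^ 5) \<Rightarrow> 'k ^ 5) \<Rightarrow> ((nat \<Rightarrow> 'k ^ 5) \<Rightarrow> 'k ^ 5) \<Rightarrow> bool"
  morphisms rep_H2_h2 cohomology_class
  by (rule h2.part_equivp_cohomologous)

instantiation H2_h2 :: (field) ab_group_add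
begin

lift_definition zero_H2_h2 :: "'k::field H2_h2" is "\<lambda>_. 0"
  by (intro h2.cohomologous_refl h2.cocycles_zero)

lift_definition plus_H2_h2 :: "'k::field H2_h2 \<Rightarrow> 'k H2_h2 \<Rightarrow> 'k H2_h2" is "\<lambda>\<phi> \<psi> v. \<phi> v + \<psi> v"
  by (rule h2.cohomologous_add)

lift_definition uminus_H2_h2 :: "'k::field H2_h2 \<Rightarrow> 'k H2_h2" is "\<lambda>\<phi> v. (-1) *s \<phi> v"
  by (rule h2.cohomologous_scale)

definition minus_H2_h2 :: "'k::field H2_h2 \<Rightarrow> 'k H2_h2 \<Rightarrow> 'k H2_h2"
  where "minus_H2_h2 x y = x + - y"

instance
proof
  fix a b c :: "'k::field H2_h2"
  show "a + b + c = a + (b + c)"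
    by transfer (simp add: add.assoc h2.cohomologous_refl h2.cocycles_add h2.cohomologous_def h2.coboundaries_zero)
  show "a + b = b + a"
    by transfer (simp add: add.commute h2.cocycles_add h2.cohomologous_def h2.coboundaries_zero)
  show "0 + a = a"
    by transfer (simp add: h2.cohomologous_def h2.coboundaries_zero)
  show "- a + a = 0"
    by transfer (simp add: h2.cohomologous_refl h2.cocycles_zero)
  show "a - b = a + - b"
    by (simp add: minus_H2_h2_def)
qed

end

lift_definition scale_H2_h2 :: "'k::field \<Rightarrow> 'k H2_h2 \<Rightarrow> 'k H2_h2" is "\<lambda>a \<phi> v. a *s \<phi> v"
  by (rule h2.cohomologous_scale)

interpretation H2: vector_space "scale_H2_h2 :: 'k::field \<Rightarrow> 'k H2_h2 \<Rightarrow> 'k H2_h2"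
proof
  fix a b :: 'k and x y :: "'k H2_h2"
  show "scale_H2_h2 a (x + y) = scale_H2_h2 a x + scale_H2_h2 a y"
    by transfer (simp add: vec.scale_right_distrib h2.cocycles_add h2.cocycles_scale h2.cohomologous_def h2.coboundaries_zero)
  show "scale_H2_h2 (a + b) x = scale_H2_h2 a x + scale_H2_h2 b x"
    by transfer (simp add: vec.scale_left_distrib h2.cocycles_add h2.cocycles_scale h2.cohomologous_def h2.coboundaries_zero)
  show "scale_H2_h2 a (scale_H2_h2 b x) = scale_H2_h2 (a * b) x"
    by transfer (simp add: h2.cocycles_scale h2.cohomologous_def h2.coboundaries_zero)
  show "scale_H2_h2 1 x = x"
    by transfer simp
qed

text \<open>The basis vectors as elements of \<open>\<hh>\<^sub>2[[t]]\<close>, and the action of \<open>\<bbbK>[[t]]\<close> on \<open>\<hh>\<^sub>2[[t]]\<close>.\<close>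

abbreviation E :: "5 \<Rightarrow> ('k::field ^ 5) fps"
  where "E i \<equiv> fps_const (ee i)"

abbreviation smult_fps :: "'k::field fps \<Rightarrow> ('k ^ 5) fps \<Rightarrow> ('k ^ 5) fps"  (infixr \<open>\<odot>\<close> 75)
  where "a \<odot> x \<equiv> cauchy (*s) a x"

end

theory Submission
  imports Defs
begin

text \<open>
  The map \<open>\<phi>\<^sub>5(p:q)\<close> is affine in \<open>(p, q)\<close>, so its classes span the same space as those of
  \<open>\<phi>\<^sub>5(0:0)\<close>, \<open>\<phi>\<^sub>5(1:0)\<close> and \<open>\<phi>\<^sub>5(0:1)\<close>. These three are independent: suppose that a combination of
  them is the coboundary of \<open>f\<close>. All brackets are multiples of \<open>e\<^sub>5\<close>, so its value at \<open>(e\<^sub>2, e\<^sub>3)\<close> has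
  no component outside \<open>e\<^sub>5\<close>, and its values at \<open>(e\<^sub>1, e\<^sub>3)\<close> and \<open>(e\<^sub>2, e\<^sub>4)\<close> both agree with
  \<open>f(e\<^sub>5)\<close> up to multiples of \<open>e\<^sub>5\<close>. This kills all coefficients.
\<close>

section \<open>The index type and Cauchy products\<close>

lemma exhaust_5:
  fixes i :: 5
  shows "i = 1 \<or> i = 2 \<or> i = 3 \<or> i = 4 \<or> i = 5"
proof (induct i)
  case (of_int z)
  \<comment> \<open>The representatives run from 0 to 4; the residue 0 is the index 5, as 5 = 0 in
    this type.\<close>
  then have "z = 0 \<or> z = 1 \<or> z = 2 \<or> z = 3 \<or> z = 4" by fastforce
  then show ?case by auto
qed

lemma forall_5: "(\<forall>i::5. P i) \<longleftrightarrow> P 1 \<and> P 2 \<and> P 3 \<and> P 4 \<and> P 5"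
  by (metis exhaust_5)

lemma cauchy_nth: "fps_nth (cauchy b x y) n = (\<Sum>i=0..n. b (fps_nth x i) (fps_nth y (n - i)))"
  by (simp add: cauchy_def)

text \<open>Reversing the summation by \<open>i\<close> to \<open>n - i\<close> exchanges the two
  series, and the skew-symmetry of \<open>b\<close> gives the sign in each term.\<close>

lemma cauchy_skew:
  fixes b :: "'a::zero \<Rightarrow> 'a \<Rightarrow> 'b::ab_group_add"
  assumes "\<And>x y. b x y = - b y x"
  shows "cauchy b x y = - cauchy b y x"
proof (rule fps_ext)
  fix n
  have "(\<Sum>i=0..n. b (fps_nth x i) (fps_nth y (n - i)))
      = (\<Sum>i=0..n. b (fps_nth x (n - i)) (fps_nth y i))"
    by (rule sum.reindex_bij_witness[of _ "\<lambda>i. n - i" "\<lambda>i. n - i"]) auto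
  also have "\<dots> = (\<Sum>i=0..n. - b (fps_nth y i) (fps_nth x (n - i)))"
    by (rule sum.cong) (auto intro: assms)
  finally show "fps_nth (cauchy b x y) n = fps_nth (- cauchy b y x) n"
    by (simp add: cauchy_nth sum_negf)
qed

lemma cauchy_fps_const:
  assumes "\<And>x. b 0 x = 0" "\<And>x. b x 0 = 0"
  shows "cauchy b (fps_const x) (fps_const y) = fps_const (b x y)"
proof (rule fps_ext)
  fix n
  have "fps_nth (cauchy b (fps_const x) (fps_const y)) n =
      (\<Sum>i=0..n. if i = 0 then b x (if n = 0 then y else 0) else 0)"
    unfolding cauchy_nth by (rule sum.cong) (auto simp: assms)
  then show "fps_nth (cauchy b (fps_const x) (fps_const y)) n = fps_nth (fps_const (b x y)) n"
    by (simp add: assms)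
qed

section \<open>Deformed brackets of a general Lie algebra\<close>

context lie_algebra
begin

lemma cauchy_scale_X_nth:
  "fps_nth (cauchy scale fps_X x) n = (if n = 0 then 0 else fps_nth x (n - 1))"
proof -
  \<comment> \<open>Only \<open>i = 1\<close> contributes. For \<open>n = 0\<close> this index lies
    outside the range, so the truncated \<open>n - 1\<close> does no harm.\<close>
  have "fps_nth (cauchy scale fps_X x) n = (\<Sum>i=0..n. if i = 1 then fps_nth x (n - 1) else 0)"
    unfolding cauchy_nth by (rule sum.cong) auto
  then show ?thesis by auto
qed

text \<open>Moves a scalar from the power series to the vector: bracket tables have entries
  \<open>(a t) \<odot> x\<close>, whereas in \<open>deformed_bracket\<close> the bare factor
  \<open>t\<close> acts on a value of \<phi>.\<close>

lemma cauchy_scale_const_X: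
  "cauchy scale (fps_const a * fps_X) (fps_const x) = cauchy scale fps_X (fps_const (scale a x))"
proof (rule fps_ext)
  fix n
  have "fps_nth (cauchy scale (fps_const a * fps_X) (fps_const x)) n =
      (\<Sum>i=0..n. if i = 1 then (if n = 1 then scale a x else 0) else 0)"
    unfolding cauchy_nth by (rule sum.cong) auto
  then show "fps_nth (cauchy scale (fps_const a * fps_X) (fps_const x)) n =
      fps_nth (cauchy scale fps_X (fps_const (scale a x))) n"
    by (auto simp: cauchy_scale_X_nth)
qed

lemma cauchy_scale_X_add:
  "cauchy scale fps_X (x + y) = cauchy scale fps_X x + cauchy scale fps_X y"
  by (rule fps_ext) (simp add: cauchy_scale_X_nth)

lemma cauchy_scale_X_minus: "cauchy scale fps_X (- x) = - cauchy scale fps_X x"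
  by (rule fps_ext) (simp add: cauchy_scale_X_nth)

lemma cauchy_scale_X_zero: "cauchy scale fps_X 0 = 0"
  by (rule fps_ext) (simp add: cauchy_scale_X_nth)

text \<open>The Jacobi identity modulo \<open>t^2\<close> only involves the coefficients 0 and 1.
  The factor \<open>t\<close> raises the degree by one, so \<phi> first enters at coefficient 1,
  evaluated on constant terms.\<close>

lemma deformed_bracket_nth_0:
  "fps_nth (deformed_bracket \<phi> x y) 0 = bracket (fps_nth x 0) (fps_nth y 0)"
  by (simp add: deformed_bracket_def cauchy_scale_X_nth cauchy_nth)

lemma deformed_bracket_nth_1:
  "fps_nth (deformed_bracket \<phi> x y) 1 =
    bracket (fps_nth x 0) (fps_nth y 1) + bracket (fps_nth x 1) (fps_nth y 0)
    + \<phi> (fps_nth x 0) (fps_nth y 0)"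
  by (simp add: deformed_bracket_def cauchy_scale_X_nth cauchy_nth)

lemma deformed_bracket_skew:
  assumes "\<And>x y. \<phi> x y = - \<phi> y x"
  shows "deformed_bracket \<phi> x y = - deformed_bracket \<phi> y x"
  unfolding deformed_bracket_def
  by (subst cauchy_skew[OF bracket_skew], subst cauchy_skew[OF assms])
    (simp add: cauchy_scale_X_minus)

lemma deformed_bracket_const:
  assumes "\<And>x. \<phi> 0 x = 0" "\<And>x. \<phi> x 0 = 0"
  shows "deformed_bracket \<phi> (fps_const x) (fps_const y) =
    fps_const (bracket x y) + cauchy scale fps_X (fps_const (\<phi> x y))"
  by (simp add: deformed_bracket_def cauchy_fps_const assms bracket_simps)

lemma cocycle_infinitesimal_deformation:
  assumes "cochain2 \<phi> \<in> cocycles 2"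
  shows "infinitesimal_deformation \<phi>"
  unfolding infinitesimal_deformation_def Let_def
proof (intro conjI allI impI)
  have cocycle: "bracket a (\<phi> b c) + \<phi> a (bracket b c) + bracket b (\<phi> c a) + \<phi> b (bracket c a)
      + bracket c (\<phi> a b) + \<phi> c (bracket a b) = 0" for a b c
    using assms unfolding cochain2_cocycle_iff by blast
  show "cochain2 \<phi> \<in> cochains 2"
    using assms by (simp add: cocycles_def)
  fix x y z and n :: nat
  let ?m = "deformed_bracket \<phi>"
  assume "n < 2"
  then consider "n = 0" | "n = 1" by linarith
  then show "fps_nth (?m x (?m y z) + ?m y (?m z x) + ?m z (?m x y)) n = 0"
  proof cases
    case 1
    then show ?thesis by (simp add: deformed_bracket_nth_0 jacobi)
  next
    case 2
    define a b c where "a = fps_nth x 0" "b = fps_nth y 0" "c = fps_nth z 0"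
    define a' b' c' where "a' = fps_nth x 1" "b' = fps_nth y 1" "c' = fps_nth z 1"
    note defs = a_b_c_def a'_b'_c'_def
    \<comment> \<open>The rows are sorted by the source of the factor \<open>t\<close>: the argument
      \<open>z\<close>, \<open>y\<close> or \<open>x\<close> in the first three, which vanish by
      \<open>jacobi\<close>, and \<phi> in the last, which vanishes by the cocycle identity.\<close>
    have "fps_nth (?m x (?m y z) + ?m y (?m z x) + ?m z (?m x y)) 1 =
        (bracket a (bracket b c') + bracket b (bracket c' a) + bracket c' (bracket a b))
      + (bracket a (bracket b' c) + bracket b' (bracket c a) + bracket c (bracket a b'))
      + (bracket a' (bracket b c) + bracket b (bracket c a') + bracket c (bracket a' b))
      + (bracket a (\<phi> b c) + \<phi> a (bracket b c) + bracket b (\<phi> c a) + \<phi> b (bracket c a)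
         + bracket c (\<phi> a b) + \<phi> c (bracket a b))"
      unfolding fps_add_nth deformed_bracket_nth_1 deformed_bracket_nth_0 defs[symmetric]
      by (simp add: bracket_simps algebra_simps)
    then show ?thesis using 2 by (simp only: jacobi cocycle add_0)
  qed
qed

end

section \<open>The cocycles \<open>phi5\<close> and their deformed brackets\<close>

lemma phi5_cochain: "cochain2 (phi5 p q) \<in> h2.cochains 2"
  unfolding h2.cochain2_in_cochains_iff
proof (intro conjI allI)
  fix x y :: "'a ^ 5"
  show "Vector_Spaces.linear (*s) (*s) (\<lambda>x. phi5 p q x y)"
    by unfold_locales (simp_all add: phi5_def wedge_def vec_eq_iff algebra_simps)
  show "Vector_Spaces.linear (*s) (*s) (\<lambda>y. phi5 p q x y)"
    by unfold_locales (simp_all add: phi5_def wedge_def vec_eq_iff algebra_simps)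
  show "phi5 p q x x = 0"
    by (simp add: phi5_def wedge_def)
qed

text \<open>Among triples of distinct basis vectors, only (e2, e3, e4) gives nonzero terms in the
  cocycle identity. They are -p e5, (p+q) e5 and -q e5, so the coefficient -(p+q) at (e3, e5) is
  exactly what makes them cancel. The check itself is done coordinate by coordinate for general
  vectors.\<close>

lemma phi5_cocycle: "cochain2 (phi5 p q) \<in> h2.cocycles 2"
  unfolding h2.cochain2_cocycle_iff
proof (intro conjI phi5_cochain allI)
  fix x y z :: "'a ^ 5"
  show "h2_bracket x (phi5 p q y z) + phi5 p q x (h2_bracket y z) +
      h2_bracket y (phi5 p q z x) + phi5 p q y (h2_bracket z x) +
      h2_bracket z (phi5 p q x y) + phi5 p q z (h2_bracket x y) = 0"
    by (simp add: phi5_def h2_bracket_def wedge_def vec_eq_iff forall_5 axis_def algebra_simps)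
qed

lemma phi5_skew: "phi5 p q x y = - phi5 p q y x"
  by (simp add: phi5_def wedge_def vec_eq_iff algebra_simps)

lemma phi5_zero: "phi5 p q 0 x = 0" "phi5 p q x 0 = 0"
  by (simp_all add: phi5_def wedge_def)

lemma phi5_deformed_bracket:
  fixes p q :: "'k::field"
  shows "let m = h2.deformed_bracket (phi5 p q); t = fps_X; c = fps_const in
          (\<forall>x y. m x y = - m y x) \<and>
          m (E 1) (E 2) = 0 \<and>
          m (E 1) (E 3) = E 5 + (c p * t) \<odot> E 1 \<and>
          m (E 1) (E 4) = 0 \<and>
          m (E 1) (E 5) = 0 \<and>
          m (E 2) (E 3) = t \<odot> E 1 + (c q * t) \<odot> E 2 + t \<odot> E 4 \<and>
          m (E 2) (E 4) = E 5 \<and>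
          m (E 2) (E 5) = 0 \<and>
          m (E 3) (E 4) = - ((c p * t) \<odot> E 4) \<and>
          m (E 3) (E 5) = - ((c (p + q) * t) \<odot> E 5) \<and>
          m (E 4) (E 5) = 0"
proof -
  have skew: "\<forall>x y. h2.deformed_bracket (phi5 p q) x y = - h2.deformed_bracket (phi5 p q) y x"
    by (intro allI h2.deformed_bracket_skew phi5_skew)
  have bracket: "h2_bracket (ee 1) (ee 2) = (0 :: 'k^5)"
    "h2_bracket (ee 1) (ee 3) = (ee 5 :: 'k^5)"
    "h2_bracket (ee 1) (ee 4) = (0 :: 'k^5)"
    "h2_bracket (ee 1) (ee 5) = (0 :: 'k^5)"
    "h2_bracket (ee 2) (ee 3) = (0 :: 'k^5)"
    "h2_bracket (ee 2) (ee 4) = (ee 5 :: 'k^5)"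
    "h2_bracket (ee 2) (ee 5) = (0 :: 'k^5)"
    "h2_bracket (ee 3) (ee 4) = (0 :: 'k^5)"
    "h2_bracket (ee 3) (ee 5) = (0 :: 'k^5)"
    "h2_bracket (ee 4) (ee 5) = (0 :: 'k^5)"
    by (simp_all add: h2_bracket_def wedge_def axis_def)
  have phi: "phi5 p q (ee 1) (ee 2) = 0"
    "phi5 p q (ee 1) (ee 3) = p *s ee 1"
    "phi5 p q (ee 1) (ee 4) = 0"
    "phi5 p q (ee 1) (ee 5) = 0"
    "phi5 p q (ee 2) (ee 3) = ee 1 + q *s ee 2 + ee 4"
    "phi5 p q (ee 2) (ee 4) = 0"
    "phi5 p q (ee 2) (ee 5) = 0"
    "phi5 p q (ee 3) (ee 4) = - (p *s ee 4)"
    "phi5 p q (ee 3) (ee 5) = - ((p + q) *s ee 5)"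
    "phi5 p q (ee 4) (ee 5) = 0"
    by (simp_all add: phi5_def wedge_def axis_def vec_eq_iff)
  show ?thesis
    \<comment> \<open>On constant series the deformed bracket is
      \<open>[x, y] + t \<phi>(x, y)\<close>, so the table reduces to values on basis vectors. All
      scalars are moved into the vectors; additivity of multiplication by \<open>t\<close> then
      matches both sides.\<close>
    unfolding Let_def h2.deformed_bracket_const[of "phi5 p q", OF phi5_zero] bracket phi
      h2.cauchy_scale_const_X
    by (intro conjI skew)
      (simp_all only: fps_const_add[symmetric] fps_const_neg[symmetric] fps_const_0_eq_0
        h2.cauchy_scale_X_add h2.cauchy_scale_X_minus h2.cauchy_scale_X_zero
        add_0_left add_0_right)
qed

section \<open>Linear relations between classes in the second cohomology\<close>

lemma cohomology_class_add:
  assumes "\<phi> \<in> h2.cocycles 2" "\<psi> \<in> h2.cocycles 2"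
  shows "cohomology_class \<phi> + cohomology_class \<psi> = cohomology_class (\<lambda>v. \<phi> v + \<psi> v)"
  using assms by (simp add: plus_H2_h2.abs_eq h2.cohomologous_refl)

lemma cohomology_class_scale:
  assumes "\<phi> \<in> h2.cocycles 2"
  shows "scale_H2_h2 a (cohomology_class \<phi>) = cohomology_class (\<lambda>v. a *s \<phi> v)"
  using assms by (simp add: scale_H2_h2.abs_eq h2.cohomologous_refl)

text \<open>The quotient is by a partial relation, so equality of classes yields
  \<open>h2.cohomologous\<close> once both representatives, \<phi> and the zero map, are known to be
  cocycles.\<close>

lemma cohomology_class_eq_0_imp_coboundary:
  assumes "\<phi> \<in> h2.cocycles 2" "cohomology_class \<phi> = 0"
  shows "\<phi> \<in> h2.coboundaries 2"
proof -
  have "h2.cohomologous 2 \<phi> (\<lambda>_. 0)"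
    using assms Quotient_rel[OF Quotient_H2_h2, of \<phi> "\<lambda>_. 0"]
    by (simp add: h2.cohomologous_refl h2.cocycles_zero zero_H2_h2_def)
  then show ?thesis by (simp add: h2.cohomologous_def)
qed

text \<open>Puts the combination into the pointwise form to which the closure rules for cocycles and
  the rules for classes apply.\<close>

lemma cochain2_phi5_combination:
  "cochain2 (\<lambda>x y. a *s phi5 0 0 x y + b *s phi5 1 0 x y + c *s phi5 0 1 x y) =
    (\<lambda>v. (a *s cochain2 (phi5 0 0) v + b *s cochain2 (phi5 1 0) v) + c *s cochain2 (phi5 0 1) v)"
  by (simp add: cochain2_def)

lemma phi5_combination_class:
  "scale_H2_h2 a (cohomology_class (cochain2 (phi5 0 0)))
    + scale_H2_h2 b (cohomology_class (cochain2 (phi5 1 0)))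
    + scale_H2_h2 c (cohomology_class (cochain2 (phi5 0 1)))
   = cohomology_class (cochain2 (\<lambda>x y. a *s phi5 0 0 x y + b *s phi5 1 0 x y + c *s phi5 0 1 x y))"
  unfolding cochain2_phi5_combination
  by (simp only: cohomology_class_scale cohomology_class_add phi5_cocycle h2.cocycles_scale
      h2.cocycles_add)

lemma phi5_classes_independent:
  fixes a b c :: "'k::field"
  assumes "scale_H2_h2 a (cohomology_class (cochain2 (phi5 0 0)))
    + scale_H2_h2 b (cohomology_class (cochain2 (phi5 1 0)))
    + scale_H2_h2 c (cohomology_class (cochain2 (phi5 0 1))) = 0"
  shows "a = 0 \<and> b = 0 \<and> c = 0"
proof -
  let ?\<phi> = "\<lambda>x y. a *s phi5 0 0 x y + b *s phi5 1 0 x y + c *s phi5 0 1 x y"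
  have "cochain2 ?\<phi> \<in> h2.cocycles 2"
    unfolding cochain2_phi5_combination
    by (simp only: h2.cocycles_add h2.cocycles_scale phi5_cocycle)
  then have "cochain2 ?\<phi> \<in> h2.coboundaries 2"
    using assms by (simp add: phi5_combination_class cohomology_class_eq_0_imp_coboundary)
  then obtain f where f: "cochain2 ?\<phi> =
      cochain2 (\<lambda>x y. f (h2_bracket x y) - h2_bracket (f x) y - h2_bracket x (f y))"
    and linear: "Vector_Spaces.linear (*s) (*s) f"
    unfolding h2.coboundaries_2_eq by blast
  have "f 0 = 0"
    using linear by (rule module_hom.zero[OF Vector_Spaces.linear.axioms(3)])
  \<comment> \<open>The sequence \<open>case_nat x (\<lambda>_. y)\<close> encodes the pair (x,
    y).\<close>
  have eq: "?\<phi> x y = f (h2_bracket x y) - h2_bracket (f x) y - h2_bracket x (f y)" for x y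
    using fun_cong[OF f, of "case_nat x (\<lambda>_. y)"] by (simp add: cochain2_def)
  \<comment> \<open>Coordinates other than the fifth annihilate both terms with
    \<open>h2_bracket\<close> outside \<open>f\<close>. At (e1, e3) only \<open>phi5 1 0\<close> has
    a nonzero value.\<close>
  have "b = f (ee 5) $ 1"
    using arg_cong[OF eq[of "ee 1" "ee 3"], of "\<lambda>v. v $ 1"]
    by (simp add: phi5_def h2_bracket_def wedge_def axis_def)
  moreover have "f (ee 5) $ 1 = 0"
    using arg_cong[OF eq[of "ee 2" "ee 4"], of "\<lambda>v. v $ 1"]
    by (simp add: phi5_def h2_bracket_def wedge_def axis_def)
  \<comment> \<open>Since [e2, e3] = 0, the term in \<open>f\<close> vanishes as well. The
    coefficient of e2 comes from \<open>phi5 0 1\<close> alone, while e1 occurs with coefficient 1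
    in all three maps, whence the sum \<open>a + b + c\<close> next.\<close>
  moreover have "c = 0"
    using arg_cong[OF eq[of "ee 2" "ee 3"], of "\<lambda>v. v $ 2"] \<open>f 0 = 0\<close>
    by (simp add: phi5_def h2_bracket_def wedge_def axis_def)
  moreover have "a + b + c = 0"
    using arg_cong[OF eq[of "ee 2" "ee 3"], of "\<lambda>v. v $ 1"] \<open>f 0 = 0\<close>
    by (simp add: phi5_def h2_bracket_def wedge_def axis_def)
  ultimately show ?thesis by simp
qed

lemma dim_span_phi5_classes:
  "H2.dim (H2.span {cohomology_class (cochain2 (phi5 p q)) | p q :: 'k::field. True}) = 3"
proof -
  let ?P = "cohomology_class (cochain2 (phi5 (0::'k) 0))"
  let ?Q = "cohomology_class (cochain2 (phi5 (1::'k) 0))"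
  let ?R = "cohomology_class (cochain2 (phi5 (0::'k) 1))"
  let ?S = "{cohomology_class (cochain2 (phi5 p q)) | p q :: 'k. True}"
  \<comment> \<open>A coincidence would be a relation with coefficients 1 and -1. Distinctness lets
    sums over the set be expanded into three terms and fixes its cardinality.\<close>
  have distinct: "?P \<noteq> ?Q" "?P \<noteq> ?R" "?Q \<noteq> ?R"
    using phi5_classes_independent[of 1 "-1 :: 'k" 0] phi5_classes_independent[of 1 0 "-1 :: 'k"]
      phi5_classes_independent[of 0 1 "-1 :: 'k"]
    by auto
  have independent: "H2.independent {?P, ?Q, ?R}"
  proof (subst H2.dependent_finite)
    show "\<not> (\<exists>u. (\<exists>v\<in>{?P, ?Q, ?R}. u v \<noteq> 0) \<and> (\<Sum>v\<in>{?P, ?Q, ?R}. scale_H2_h2 (u v) v) = 0)"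
    proof clarify
      fix u v
      assume "v \<in> {?P, ?Q, ?R}" "u v \<noteq> 0" "(\<Sum>v\<in>{?P, ?Q, ?R}. scale_H2_h2 (u v) v) = 0"
      then show False
        using phi5_classes_independent[of "u ?P" "u ?Q" "u ?R"] distinct
        by (auto simp: add.assoc)
    qed
  qed simp
  have "cohomology_class (cochain2 (phi5 p q)) \<in> H2.span {?P, ?Q, ?R}" for p q :: 'k
  proof -
    \<comment> \<open>The coefficients must add up to 1, because the part e1 + e4 of the value at
      (e2, e3) is independent of \<open>p\<close> and \<open>q\<close>.\<close>
    have "phi5 p q = (\<lambda>x y. (1 - p - q) *s phi5 0 0 x y + p *s phi5 1 0 x y + q *s phi5 0 1 x y)"
      by (simp add: fun_eq_iff vec_eq_iff phi5_def algebra_simps)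
    then have "cohomology_class (cochain2 (phi5 p q)) =
        scale_H2_h2 (1 - p - q) ?P + scale_H2_h2 p ?Q + scale_H2_h2 q ?R"
      by (simp add: phi5_combination_class)
    then show ?thesis
      by (auto intro!: H2.span_add H2.span_scale intro: H2.span_base)
  qed
  then have "?S \<subseteq> H2.span {?P, ?Q, ?R}" by blast
  moreover have "{?P, ?Q, ?R} \<subseteq> H2.span ?S"
    unfolding insert_subset by (intro conjI empty_subsetI H2.span_base) blast+
  ultimately have "H2.span {?P, ?Q, ?R} = H2.span ?S"
    by (simp only: H2.span_eq simp_thms)
  then have "H2.dim (H2.span ?S) = card {?P, ?Q, ?R}"
    using independent by (metis H2.dim_span H2.dim_span_eq_card_independent)
  then show ?thesis using distinct by simp
qed

theorem theorem4p3:
  shows "((\<forall>p q :: real.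
        cochain2 (phi5 p q) \<in> h2.cocycles 2 \<and>
        h2.infinitesimal_deformation (phi5 p q) \<and>
        (let m = h2.deformed_bracket (phi5 p q); t = fps_X; c = fps_const in
          (\<forall>x y. m x y = - m y x) \<and>
          m (E 1) (E 2) = 0 \<and>
          m (E 1) (E 3) = E 5 + (c p * t) \<odot> E 1 \<and>
          m (E 1) (E 4) = 0 \<and>
          m (E 1) (E 5) = 0 \<and>
          m (E 2) (E 3) = t \<odot> E 1 + (c q * t) \<odot> E 2 + t \<odot> E 4 \<and>
          m (E 2) (E 4) = E 5 \<and>
          m (E 2) (E 5) = 0 \<and>
          m (E 3) (E 4) = - ((c p * t) \<odot> E 4) \<and>
          m (E 3) (E 5) = - ((c (p + q) * t) \<odot> E 5) \<and>
          m (E 4) (E 5) = 0)) \<and>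
      H2.dim (H2.span {cohomology_class (cochain2 (phi5 p q)) | p q :: real. True}) = 3) \<and>
    ((\<forall>p q :: complex.
        cochain2 (phi5 p q) \<in> h2.cocycles 2 \<and>
        h2.infinitesimal_deformation (phi5 p q) \<and>
        (let m = h2.deformed_bracket (phi5 p q); t = fps_X; c = fps_const in
          (\<forall>x y. m x y = - m y x) \<and>
          m (E 1) (E 2) = 0 \<and>
          m (E 1) (E 3) = E 5 + (c p * t) \<odot> E 1 \<and>
          m (E 1) (E 4) = 0 \<and>
          m (E 1) (E 5) = 0 \<and>
          m (E 2) (E 3) = t \<odot> E 1 + (c q * t) \<odot> E 2 + t \<odot> E 4 \<and>
          m (E 2) (E 4) = E 5 \<and>
          m (E 2) (E 5) = 0 \<and>
          m (E 3) (E 4) = - ((c p * t) \<odot> E 4) \<and>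
          m (E 3) (E 5) = - ((c (p + q) * t) \<odot> E 5) \<and>
          m (E 4) (E 5) = 0)) \<and>
      H2.dim (H2.span {cohomology_class (cochain2 (phi5 p q)) | p q :: complex. True}) = 3)"
  \<comment> \<open>Each part holds over an arbitrary field, so the real and complex cases are both
    instances.\<close>
  by (intro conjI allI phi5_cocycle h2.cocycle_infinitesimal_deformation phi5_deformed_bracket
      dim_span_phi5_classes)

end
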